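(* Let $C_{\mathrm{sym}}(H)$ denote the number of nontrivial centered symmetric configurations of centered height at most $H$, counted with unordered multiset conventions and including both center classes. Then, as $H\to\infty$, $$C_{\mathrm{sym}}(H)=\frac{2\log 2}{\pi^2}\,H^2\log H+O(H^2).$$
   Context: A symmetric ideal degree-three Prouhet--Tarry--Escott solution is a pair $(A,B)$ of four-element multisets of integers with equal sums of $\ell$-th powers for $\ell=1,2,3$, such that for some $c\in\frac12\mathbb Z$ both $A-c$ and $B-c$ are invariant under $t\mapsto -t$. Subtracting the center $c$ gives a centered symmetric configuration: a pair of multisets $$A_0=\{\pm x,\pm y\},\qquad B_0=\{\pm u,\pm v\},\qquad x^2+y^2=u^2+v^2,$$ with $0\le x\le y$, $0\le u\le v$, where either $x,y,u,v$ are all in $\mathbb Z$ (integer-centered class) or $x,y,u,v$ are all in $\mathbb Z+\frac12$ (half-integer-centered class). Its centered height is $\max\{x,y,u,v\}$. It is nontrivial if $\{x,y\}\ne\{u,v\}$ as multisets. The pairs $(A_0,B_0)$ and $(B_0,A_0)$ are identified. Thus $C_{\mathrm{sym}}(H)$ is the total number, over the two classes, of unordered pairs of distinct multisets $\{x,y\}\neq\{u,v\}$ of nonnegative numbers, with $x,y,u,v$ all in $\mathbb Z$ (for the integer-centered class) or all in $\mathbb Z+\frac12$ (for the half-integer-centered class), with all of $x,y,u,v\le H$ and $x^2+y^2=u^2+v^2$. (Different integer translates are not counted separately here.) *)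

theory Defs
  imports "HOL-Analysis.Analysis" "HOL-Library.Multiset" "HOL-Library.Landau_Symbols"
begin

definition half_odd :: "real set" where
  "half_odd = {x. x - 1 / 2 \<in> \<int>}"

definition pm_multiset :: "real \<Rightarrow> real \<Rightarrow> real multiset" where
  "pm_multiset x y = {#x, - x, y, - y#}"

text \<open>
  The parameter \<open>K\<close> is the centre class, either \<open>\<int>\<close> or \<open>half_odd\<close>.  A configuration is
  the two-element set \<open>{A, B}\<close> rather than the pair \<open>(A, B)\<close>, because \<open>(A, B)\<close> and \<open>(B, A)\<close>
  are identified; nontriviality makes \<open>A\<close> and \<open>B\<close> distinct.
\<close>

definition nontrivial_sym_configs :: "real set \<Rightarrow> real \<Rightarrow> real multiset set set" where
  "nontrivial_sym_configs K H =
     {{pm_multiset x y, pm_multiset u v} | x y u v.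
        x \<in> K \<and> y \<in> K \<and> u \<in> K \<and> v \<in> K \<and>
        0 \<le> x \<and> x \<le> y \<and> 0 \<le> u \<and> u \<le> v \<and>
        x\<^sup>2 + y\<^sup>2 = u\<^sup>2 + v\<^sup>2 \<and>
        {#x, y#} \<noteq> {#u, v#} \<and>
        Max {x, y, u, v} \<le> H}"

definition C_sym :: "real \<Rightarrow> nat" where
  "C_sym H = card (nontrivial_sym_configs \<int> H) + card (nontrivial_sym_configs half_odd H)"

lemma pm_multiset_eq_iff:
  assumes "0 \<le> x" "0 \<le> y" "0 \<le> u" "0 \<le> v"
  shows "pm_multiset x y = pm_multiset u v \<longleftrightarrow> {#x, y#} = {#u, v#}"
proof
  assume "pm_multiset x y = pm_multiset u v"
  then have "image_mset abs (pm_multiset x y) = image_mset abs (pm_multiset u v)" by simp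
  then have "{#x, y#} + {#x, y#} = {#u, v#} + {#u, v#}"
    using assms by (simp add: pm_multiset_def add_mset_commute)
  then have "2 * count {#x, y#} a = 2 * count {#u, v#} a" for a
    by (metis count_union mult_2)
  then show "{#x, y#} = {#u, v#}" by (intro multiset_eqI) simp
next
  assume "{#x, y#} = {#u, v#}"
  then show "pm_multiset x y = pm_multiset u v"
    by (auto simp: pm_multiset_def add_eq_conv_ex)
qed

text \<open>The sets counted by \<open>card\<close> are finite, so \<open>C_sym\<close> is a genuine count.\<close>

lemma finite_Ints_Icc: "finite {x \<in> \<int>. \<bar>x\<bar> \<le> (H::real)}"
proof (rule finite_subset)
  show "{x \<in> \<int>. \<bar>x\<bar> \<le> H} \<subseteq> real_of_int ` {- \<lfloor>H\<rfloor>..\<lfloor>H\<rfloor>}"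
  proof
    fix x assume "x \<in> {x \<in> \<int>. \<bar>x\<bar> \<le> H}"
    then obtain n where n: "x = of_int n" "\<bar>real_of_int n\<bar> \<le> H" by (auto elim: Ints_cases)
    then have "\<bar>n\<bar> \<le> \<lfloor>H\<rfloor>" by (simp add: le_floor_iff)
    then have "n \<in> {- \<lfloor>H\<rfloor>..\<lfloor>H\<rfloor>}" by auto
    with n show "x \<in> real_of_int ` {- \<lfloor>H\<rfloor>..\<lfloor>H\<rfloor>}" by blast
  qed
qed simp

lemma finite_half_odd_Icc: "finite {x \<in> half_odd. \<bar>x\<bar> \<le> H}"
proof (rule finite_subset)
  show "{x \<in> half_odd. \<bar>x\<bar> \<le> H} \<subseteq> (\<lambda>x. x + 1 / 2) ` {x \<in> \<int>. \<bar>x\<bar> \<le> H + 1}"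
  proof
    fix x assume x: "x \<in> {x \<in> half_odd. \<bar>x\<bar> \<le> H}"
    then have "x - 1 / 2 \<in> {x \<in> \<int>. \<bar>x\<bar> \<le> H + 1}" by (auto simp: half_odd_def)
    then show "x \<in> (\<lambda>x. x + 1 / 2) ` {x \<in> \<int>. \<bar>x\<bar> \<le> H + 1}"
      by (rule rev_image_eqI) simp
  qed
qed (intro finite_imageI finite_Ints_Icc)

lemma finite_nontrivial_sym_configs:
  assumes "K = \<int> \<or> K = half_odd"
  shows "finite (nontrivial_sym_configs K H)"
proof -
  let ?S = "{x \<in> K. \<bar>x\<bar> \<le> H}"
  let ?M = "(\<lambda>(x, y). pm_multiset x y) ` (?S \<times> ?S)"
  have "finite ?S"
    using assms finite_Ints_Icc finite_half_odd_Icc by auto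
  then have "finite ((\<lambda>(A, B). {A, B}) ` (?M \<times> ?M))"
    by (intro finite_imageI finite_cartesian_product)
  moreover have "nontrivial_sym_configs K H \<subseteq> (\<lambda>(A, B). {A, B}) ` (?M \<times> ?M)"
  proof
    fix X assume "X \<in> nontrivial_sym_configs K H"
    then obtain x y u v where X: "X = {pm_multiset x y, pm_multiset u v}"
      and "x \<in> ?S" "y \<in> ?S" "u \<in> ?S" "v \<in> ?S"
      unfolding nontrivial_sym_configs_def by auto
    then have "pm_multiset x y \<in> ?M" "pm_multiset u v \<in> ?M"
      by force+
    then show "X \<in> (\<lambda>(A, B). {A, B}) ` (?M \<times> ?M)"
      unfolding X by (intro image_eqI[of _ _ "(pm_multiset x y, pm_multiset u v)"]) auto
  qed
  ultimately show ?thesis by (rule finite_subset[rotated])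
qed

end

theory Submission
  imports Defs
begin

text \<open>
  Doubling all entries merges the two centre classes into the integer solutions of
  \<open>x\<^sup>2 + y\<^sup>2 = u\<^sup>2 + v\<^sup>2\<close> whose entries share one parity and are at most \<open>N = \<lfloor>2 * H\<rfloor>\<close>.
  Let \<open>y\<close> be the largest entry.  Dropping the conditions \<open>u \<le> v\<close> and \<open>x \<ge> 0\<close> multiplies the
  count by \<open>4\<close>, up to the \<open>O(N\<^sup>2)\<close> degenerate solutions with \<open>x = 0\<close> or \<open>u = v\<close>, and
  it makes the remaining inequalities symmetric: factoring \<open>(y - v) * (y + v) = (u - x) * (u + x)\<close>
  gives \<open>y = m * s + n * t\<close>, \<open>u = m * t + n * s\<close>, \<open>v = n * t - m * s\<close>, \<open>x = n * s - m * t\<close>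
  with \<open>0 < m < n\<close>, with coprime \<open>0 < s < t\<close>, and with \<open>m \<equiv> n\<close> or \<open>s \<equiv> t\<close> modulo \<open>2\<close>.

  For fixed \<open>(s, t)\<close> the pairs \<open>(m, n)\<close> with \<open>m \<equiv> n\<close> modulo \<open>q\<close> are the lattice points of a
  triangle, so their number is \<open>N\<^sup>2 / (2 * q * t * (s + t)) + O(N / t)\<close>.  It remains to sum
  \<open>1 / (t * (s + t))\<close> over coprime \<open>s < t \<le> N\<close>, once over all such pairs and once over the odd ones.
  Without coprimality the sum is \<open>ln 2 / q\<^sup>2 * ln N + O(1)\<close> with \<open>q = 1\<close> or \<open>q = 2\<close>.
  Sorting by the greatest common divisor \<open>d\<close> expresses it as the sum of \<open>P (N / d) / d\<^sup>2\<close>,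
  where \<open>P\<close> is the coprime sum; since \<open>P N - P (N / d) = O(1 + ln d)\<close>, it is
  \<open>(\<Sum>d. 1 / d\<^sup>2) * P N + O(1)\<close>, and no Moebius inversion is needed.
\<close>

section \<open>Reduction to a parametrised set\<close>

definition prim_quads :: "nat \<Rightarrow> (nat \<times> nat \<times> nat \<times> nat) set" where
  "prim_quads N = {(m, n, s, t). 0 < m \<and> m < n \<and> 0 < s \<and> s < t \<and> coprime s t \<and>
     m * s + n * t \<le> N \<and> (even m = even n \<or> even s = even t)}"

text \<open>The sign of \<open>x\<close> and the order of \<open>u\<close> and \<open>v\<close> are
  left free. The strict inequalities make \<open>y\<close> the unique largest entry, which excludes
  the trivial solutions.\<close>

definition signed_solutions :: "nat \<Rightarrow> (int \<times> int \<times> int \<times> int) set" where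
  "signed_solutions N = {(x, u, v, y). \<bar>x\<bar> < u \<and> u < y \<and> \<bar>x\<bar> < v \<and> v < y \<and> y \<le> int N \<and>
     even x = even y \<and> even u = even y \<and> even v = even y \<and> x\<^sup>2 + y\<^sup>2 = u\<^sup>2 + v\<^sup>2}"

definition ordered_solutions :: "nat \<Rightarrow> (int \<times> int \<times> int \<times> int) set" where
  "ordered_solutions N = {(x, u, v, y). 0 \<le> x \<and> x < u \<and> u \<le> v \<and> v < y \<and> y \<le> int N \<and>
     even x = even y \<and> even u = even y \<and> even v = even y \<and> x\<^sup>2 + y\<^sup>2 = u\<^sup>2 + v\<^sup>2}"

lemma finite_signed_solutions: "finite (signed_solutions N)"
  by (rule finite_subset[of _ "{- int N..int N} \<times> {- int N..int N} \<times> {- int N..int N} \<times> {- int N..int N}"])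
    (auto simp: signed_solutions_def)

text \<open>With \<open>a = m * s\<close>, \<open>b = n * t\<close>, \<open>c = m * t\<close>,
  \<open>d = n * s\<close>, so that \<open>a * b = c * d\<close>, the entries are
  \<open>x = d - c\<close>, \<open>u = c + d\<close>, \<open>v = b - a\<close>,
  \<open>y = a + b\<close>.\<close>

definition quad_solution :: "nat \<times> nat \<times> nat \<times> nat \<Rightarrow> int \<times> int \<times> int \<times> int" where
  "quad_solution = (\<lambda>(m, n, s, t). (int (n * s) - int (m * t), int (m * t + n * s),
     int (n * t) - int (m * s), int (m * s + n * t)))"

lemma quad_solution_mem:
  assumes "q \<in> prim_quads N"
  shows "quad_solution q \<in> signed_solutions N"
proof -
  obtain m n s t where q: "q = (m, n, s, t)" and h: "0 < m" "m < n" "0 < s" "s < t"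
      "m * s + n * t \<le> N" "even m = even n \<or> even s = even t"
    using assms by (auto simp: prim_quads_def)
  define m' n' s' t' where "m' = int m" "n' = int n" "s' = int s" "t' = int t"
  note defs = this
  \<comment> \<open>These products are half of \<open>u - x\<close>, \<open>u + x\<close> and
    \<open>y - v\<close>, followed by \<open>y - u\<close>, \<open>v - x\<close> and
    \<open>v + x\<close>; their positivity is all of the required inequalities.\<close>
  have pos: "m' * t' > 0" "n' * s' > 0" "m' * s' > 0" "(n' - m') * (t' - s') > 0"
      "(n' + m') * (t' - s') > 0" "(n' - m') * (t' + s') > 0"
    using h by (simp_all add: defs)
  have le: "m' * s' + n' * t' \<le> int N"
    using h(5) by (simp add: defs flip: of_nat_mult of_nat_add)
  have parity: "even m' = even n' \<or> even s' = even t'"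
    using h by (simp add: defs)
  have "quad_solution q = (n' * s' - m' * t', m' * t' + n' * s', n' * t' - m' * s', m' * s' + n' * t')"
    by (simp add: quad_solution_def q defs)
  moreover have "(n' * s' - m' * t')\<^sup>2 + (m' * s' + n' * t')\<^sup>2 = (m' * t' + n' * s')\<^sup>2 + (n' * t' - m' * s')\<^sup>2"
    by algebra
  moreover have "\<bar>n' * s' - m' * t'\<bar> < m' * t' + n' * s'"
    using pos by linarith
  moreover have "\<bar>n' * s' - m' * t'\<bar> < n' * t' - m' * s'" "m' * t' + n' * s' < m' * s' + n' * t'"
    using pos by (auto simp: algebra_simps abs_less_iff)
  moreover have "n' * t' - m' * s' < m' * s' + n' * t'"
    using pos by linarith
  ultimately show ?thesis
    using le parity by (auto simp: signed_solutions_def)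
qed

lemma inj_on_quad_solution: "inj_on quad_solution (prim_quads N)"
proof (rule inj_onI)
  fix p p'
  assume p: "p \<in> prim_quads N" "p' \<in> prim_quads N" "quad_solution p = quad_solution p'"
  obtain m n s t m' n' s' t' where pp: "p = (m, n, s, t)" "p' = (m', n', s', t')"
    by (metis prod_cases4)
  with p have q: "(m, n, s, t) \<in> prim_quads N" "(m', n', s', t') \<in> prim_quads N"
    and "quad_solution (m, n, s, t) = quad_solution (m', n', s', t')"
    by simp_all
  then have "int (m * s) = int (m' * s')" "int (m * t) = int (m' * t')" "int (n * t) = int (n' * t')"
    by (auto simp: quad_solution_def)
  then have eq: "m * s = m' * s'" "m * t = m' * t'" "n * t = n' * t'"
    by (simp_all only: of_nat_eq_iff)
  \<comment> \<open>Coprimality of \<open>s\<close> and \<open>t\<close> recovers \<open>m\<close>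
    from the two products; the other parameters follow by cancellation.\<close>
  have "m = gcd (m * s) (m * t)" "m' = gcd (m' * s') (m' * t')"
    using q by (simp_all add: prim_quads_def gcd_mult_distrib_nat[symmetric])
  then have "m = m'"
    using eq by simp
  then show "p = p'"
    using eq q by (auto simp: prim_quads_def pp)
qed

lemma quad_solution_surj:
  assumes "p \<in> signed_solutions N"
  shows "p \<in> quad_solution ` prim_quads N"
proof -
  obtain x u v y where p: "p = (x, u, v, y)" and h: "\<bar>x\<bar> < u" "u < y" "\<bar>x\<bar> < v" "v < y" "y \<le> int N"
      "even x = even y" "even u = even y" "even v = even y" "x\<^sup>2 + y\<^sup>2 = u\<^sup>2 + v\<^sup>2"
    using assms by (auto simp: signed_solutions_def)
  \<comment> \<open>The common parity of the entries makes all four halves exact, and the equation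
    becomes \<open>a * b = c * d\<close>.\<close>
  define a b c d where "a = nat ((y - v) div 2)" "b = nat ((y + v) div 2)"
    "c = nat ((u - x) div 2)" "d = nat ((u + x) div 2)"
  note defs = this
  have "2 * int a = y - v" "2 * int b = y + v" "2 * int c = u - x" "2 * int d = u + x"
    using h by (simp_all add: defs)
  then have xy: "x = int d - int c" "u = int c + int d" "v = int b - int a" "y = int a + int b"
    by linarith+
  have "int a * int b = int c * int d"
    using h(9) unfolding xy by (simp add: power2_eq_square algebra_simps)
  then have eq: "a * b = c * d"
    by (simp flip: of_nat_mult)
  have bcd: "c < b" "d < b" "0 < a" "0 < c" "0 < d"
    using h(1-4) unfolding xy by linarith+
  \<comment> \<open>Replacing one factor of \<open>c * d\<close> by the larger \<open>b\<close>
    leaves products that compare \<open>a\<close> with \<open>c\<close> and with \<open>d\<close>;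
    this yields \<open>s < t\<close> and \<open>m < n\<close> below.\<close>
  have "a * b < c * b" "a * b < d * b"
    using bcd by (auto simp: eq mult.commute)
  then have "a < c" "a < d"
    by auto
  \<comment> \<open>Taking the gcd out of \<open>a\<close> and \<open>c\<close> leaves
    \<open>s * b = t * d\<close> with \<open>s\<close> and \<open>t\<close> coprime, so
    \<open>t\<close> divides \<open>b\<close>, and the quotient is \<open>n\<close>.\<close>
  define m where "m = gcd a c"
  obtain s t where st: "a = m * s" "c = m * t" "coprime s t"
    using bcd unfolding m_def by (metis gcd_coprime_exists mult.commute gcd_eq_0_iff less_irrefl)
  have "m > 0" "s > 0" "t > 0"
    using st bcd by auto
  have "s * b = t * d"
    using eq \<open>m > 0\<close> by (simp add: st mult.assoc)
  then have "t dvd b"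
    using \<open>coprime s t\<close> by (metis coprime_commute coprime_dvd_mult_right_iff dvd_triv_left)
  then obtain n where b: "b = n * t"
    by (metis dvdE mult.commute)
  have d: "d = n * s"
    using \<open>s * b = t * d\<close> \<open>t > 0\<close> by (simp add: b mult.commute)
  have "s < t" "m < n"
    using \<open>a < c\<close> \<open>a < d\<close> by (auto simp: st d)
  moreover have "m * s + n * t \<le> N"
    using h(5) unfolding xy by (simp add: st b flip: of_nat_add of_nat_mult)
  moreover have "even m = even n \<or> even s = even t"
    using h(7) unfolding xy by (auto simp: st b d)
  ultimately have "(m, n, s, t) \<in> prim_quads N"
    using \<open>m > 0\<close> \<open>s > 0\<close> st by (simp add: prim_quads_def)
  moreover have "quad_solution (m, n, s, t) = p"
    by (simp add: quad_solution_def p xy st b d)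
  ultimately show ?thesis
    by (metis image_eqI)
qed

lemma card_signed_solutions: "card (signed_solutions N) = card (prim_quads N)"
proof -
  have "quad_solution ` prim_quads N = signed_solutions N"
    using quad_solution_mem quad_solution_surj by blast
  then show ?thesis
    using card_image[OF inj_on_quad_solution] by metis
qed

text \<open>Off the degenerate set \<open>D\<close>, the sign of \<open>x\<close> and the order of
  \<open>u\<close> and \<open>v\<close> are two free binary choices, which gives the factor 4. The
  set \<open>D\<close> is of quadratic size and affects both counts only within that order.\<close>

lemma card_signed_ordered:
  "\<bar>real (card (signed_solutions N)) - 4 * real (card (ordered_solutions N))\<bar> \<le> 8 * (2 * real N + 1)\<^sup>2"
proof -
  define D where "D = {(x, u, v, y) \<in> signed_solutions N. x = 0 \<or> u = v}"
  define E where "E = {(x, u, v, y) \<in> signed_solutions N. 0 < x \<and> u < v}"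
  define R where "R = {- int N..int N} \<times> {- int N..int N}"
  have R: "finite R" "card R = (2 * N + 1)\<^sup>2"
    by (simp_all add: R_def power2_eq_square nat_add_distrib nat_mult_distrib)
  have fin: "finite D" "finite E"
    using finite_signed_solutions by (auto simp: D_def E_def intro: finite_subset)
  \<comment> \<open>When \<open>x = 0\<close> or \<open>u = v\<close>, two entries determine the
    rest: the equation fixes a square, and positivity fixes its root.\<close>
  have "card {(x, u, v, y) \<in> signed_solutions N. x = 0} \<le> card R"
    by (rule card_inj_on_le[where f = "\<lambda>(x, u, v, y). (u, y)"])
      (auto simp: R inj_on_def signed_solutions_def R_def power2_eq_iff)
  moreover have "card {(x, u, v, y) \<in> signed_solutions N. u = v} \<le> card R"
    by (rule card_inj_on_le[where f = "\<lambda>(x, u, v, y). (x, y)"])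
      (auto simp: R inj_on_def signed_solutions_def R_def power2_eq_iff)
  moreover have "card D \<le> card {(x, u, v, y) \<in> signed_solutions N. x = 0} + card {(x, u, v, y) \<in> signed_solutions N. u = v}"
    by (rule order_trans[OF card_mono card_Un_le])
      (auto simp: D_def intro: finite_subset[OF _ finite_signed_solutions])
  ultimately have "card D \<le> 2 * (2 * N + 1)\<^sup>2"
    using R by linarith
  then have D: "real (card D) \<le> 2 * (2 * real N + 1)\<^sup>2"
    by (metis (mono_tags, opaque_lifting) of_nat_1 of_nat_add of_nat_le_iff of_nat_mult of_nat_numeral of_nat_power)
  \<comment> \<open>The two booleans record the sign of \<open>x\<close> and whether
    \<open>u\<close> comes before \<open>v\<close>.\<close>
  have "bij_betw (\<lambda>(x, u, v, y). ((\<bar>x\<bar>, min u v, max u v, y), 0 < x, u < v))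
      (signed_solutions N - D) (E \<times> UNIV)"
  proof (rule bij_betwI[where g = "\<lambda>((x, u, v, y), p, q).
      (if p then x else - x, if q then u else v, if q then v else u, y)"], goal_cases)
    case 1
    have "((\<bar>x\<bar>, min u v, max u v, y), 0 < x, u < v) \<in> E \<times> UNIV"
      if "(x, u, v, y) \<in> signed_solutions N - D" for x u v y
      using that unfolding D_def E_def signed_solutions_def by (cases "u < v") auto
    then show ?case
      by auto
  next
    case 2
    have "(if p then x else - x, if q then u else v, if q then v else u, y) \<in> signed_solutions N - D"
      if "(x, u, v, y) \<in> E" for x u v y p q
      using that unfolding D_def E_def signed_solutions_def by (cases p; cases q) auto
    then show ?case
      by auto
  next
    case (3 p)
    then show ?case
      by (cases p) (auto simp: D_def)
  next
    case (4 p)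
    then show ?case
      by (auto simp: E_def signed_solutions_def split: if_splits)
  qed
  from bij_betw_same_card[OF this] have "card (signed_solutions N - D) = 4 * card E"
    by (simp add: card_cartesian_product UNIV_bool flip: UNIV_Times_UNIV)
  moreover have "D \<subseteq> signed_solutions N"
    by (auto simp: D_def)
  ultimately have signed: "card (signed_solutions N) = 4 * card E + card D"
    using card_Diff_subset[of D "signed_solutions N"] card_mono[OF finite_signed_solutions, of D N] fin by linarith
  have "E \<subseteq> ordered_solutions N" "ordered_solutions N \<subseteq> E \<union> D"
    by (auto simp: E_def D_def ordered_solutions_def signed_solutions_def)
  then have "card E \<le> card (ordered_solutions N)" "card (ordered_solutions N) \<le> card E + card D"
    using fin by (auto intro: card_mono finite_subset order_trans[OF card_mono card_Un_le])
  then show ?thesis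
    using signed D by simp
qed

section \<open>Configurations as halved integer quadruples\<close>

definition config_of :: "int \<times> int \<times> int \<times> int \<Rightarrow> real multiset set" where
  "config_of = (\<lambda>(x, u, v, y). {pm_multiset (x / 2) (y / 2), pm_multiset (u / 2) (v / 2)})"

lemma pm_multiset_half_eq_iff:
  fixes x y u v :: int
  assumes "0 \<le> x" "x \<le> y" "0 \<le> u" "u \<le> v"
  shows "pm_multiset (x / 2) (y / 2) = pm_multiset (u / 2) (v / 2) \<longleftrightarrow> x = u \<and> y = v"
  using assms by (subst pm_multiset_eq_iff) (auto simp: add_eq_conv_ex)

text \<open>The order within each pair makes it readable from its multiset, and the two multisets
  cannot be exchanged because \<open>v < y\<close> says which one holds the largest entry.\<close>

lemma inj_on_config_of: "inj_on config_of (ordered_solutions N)"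
  by (auto simp: inj_on_def config_of_def ordered_solutions_def doubleton_eq_iff pm_multiset_half_eq_iff)

text \<open>The predicate \<open>R\<close> stands for "even" or "odd", so that one argument serves
  both centre classes. The multiset with the larger maximum is listed as the one of \<open>x\<close>
  and \<open>y\<close>.\<close>

lemma nontrivial_sym_configs_eq_image:
  fixes R :: "int \<Rightarrow> bool"
  assumes K: "K = (\<lambda>k. real_of_int k / 2) ` {k. R k}"
    and R: "\<And>i j. R i \<Longrightarrow> R j \<longleftrightarrow> even i = even j" and H: "H \<ge> 0"
  shows "nontrivial_sym_configs K H =
    config_of ` {(x, u, v, y) \<in> ordered_solutions (nat \<lfloor>2 * H\<rfloor>). R y}"
    (is "_ = config_of ` ?S")
proof (intro equalityI subsetI)
  fix X assume "X \<in> config_of ` ?S"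
  then obtain x u v y where X: "X = config_of (x, u, v, y)" and S: "(x, u, v, y) \<in> ?S"
    by auto
  then have h: "0 \<le> x" "x < u" "u \<le> v" "v < y" "real_of_int y \<le> 2 * H" "x\<^sup>2 + y\<^sup>2 = u\<^sup>2 + v\<^sup>2"
      "R y" "R x" "R u" "R v"
    using H by (auto simp: ordered_solutions_def le_nat_iff le_floor_iff R[of y])
  have "real_of_int (x\<^sup>2 + y\<^sup>2) = real_of_int (u\<^sup>2 + v\<^sup>2)"
    using h by (simp only:)
  then have "(x / 2)\<^sup>2 + (y / 2)\<^sup>2 = (u / 2)\<^sup>2 + (v / 2)\<^sup>2"
    by (simp add: power_divide flip: add_divide_distrib)
  moreover have "{#x / 2, y / 2#} \<noteq> {#u / 2, v / 2#}"
    using h by (auto simp: add_eq_conv_ex)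
  ultimately show "X \<in> nontrivial_sym_configs K H"
    unfolding nontrivial_sym_configs_def X config_of_def using h
    by (intro CollectI exI[of _ "x / 2"] exI[of _ "y / 2"] exI[of _ "u / 2"] exI[of _ "v / 2"])
      (auto simp: K)
next
  fix X assume "X \<in> nontrivial_sym_configs K H"
  then obtain x y u v :: int where X: "X = {pm_multiset (x / 2) (y / 2), pm_multiset (u / 2) (v / 2)}"
    and h: "R x" "R y" "R u" "R v" "0 \<le> x" "x \<le> y" "0 \<le> u" "u \<le> v"
      "(x / 2)\<^sup>2 + (y / 2)\<^sup>2 = (u / 2)\<^sup>2 + (v / 2)\<^sup>2" "{#x / 2, y / 2#} \<noteq> {#u / 2, v / 2#}"
      "real_of_int y \<le> 2 * H" "real_of_int v \<le> 2 * H"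
    unfolding nontrivial_sym_configs_def K by auto
  from h(9) have "real_of_int (x\<^sup>2 + y\<^sup>2) = real_of_int (u\<^sup>2 + v\<^sup>2)"
    by (simp add: power_divide flip: add_divide_distrib)
  then have eq: "x\<^sup>2 + y\<^sup>2 = u\<^sup>2 + v\<^sup>2"
    by (simp only: of_int_eq_iff)
  have mem: "(x, u, v, y) \<in> ?S" if "v < y" "R x" "R y" "R u" "R v" "0 \<le> x" "0 \<le> u" "u \<le> v"
      "x\<^sup>2 + y\<^sup>2 = u\<^sup>2 + v\<^sup>2" "real_of_int y \<le> 2 * H" for x y u v :: int
  proof -
    have "v\<^sup>2 < y\<^sup>2"
      using that by (intro power_strict_mono) auto
    then have "x\<^sup>2 < u\<^sup>2"
      using that by linarith
    then have "x < u"
      using that power_less_imp_less_base by blast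
    then show ?thesis
      using that H R[of y] by (auto simp: ordered_solutions_def le_nat_iff le_floor_iff)
  qed
  consider "v < y" | "y < v" | "y = v"
    by linarith
  then show "X \<in> config_of ` ?S"
  proof cases
    case 1
    then show ?thesis
      using h eq by (intro image_eqI[OF _ mem[of v y x u]]) (simp_all add: X config_of_def)
  next
    case 2
    then show ?thesis
      using h eq by (intro image_eqI[OF _ mem[of y v u x]]) (simp_all add: X config_of_def insert_commute)
  next
    \<comment> \<open>Equal maxima force equal minima, contradicting nontriviality.\<close>
    case 3
    then show ?thesis
      using h eq by (simp add: power2_eq_iff_nonneg)
  qed
qed

text \<open>Integers are the halves of even numbers and half-odd numbers the halves of odd ones, so
  the parity of \<open>y\<close> splits the ordered solutions into the two classes.\<close>

lemma C_sym_eq_card: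
  assumes "H \<ge> 0"
  shows "C_sym H = card (ordered_solutions (nat \<lfloor>2 * H\<rfloor>))"
proof -
  define S where "S = ordered_solutions (nat \<lfloor>2 * H\<rfloor>)"
  have "\<int> = (\<lambda>k. real_of_int k / 2) ` {k. even k}"
  proof (intro equalityI subsetI)
    fix x :: real assume "x \<in> \<int>"
    then obtain k where "x = of_int k" by (elim Ints_cases)
    then show "x \<in> (\<lambda>k. real_of_int k / 2) ` {k. even k}"
      by (intro image_eqI[of _ _ "2 * k"]) auto
  qed (auto elim!: evenE)
  from nontrivial_sym_configs_eq_image[OF this _ assms]
  have even: "nontrivial_sym_configs \<int> H = config_of ` {(x, u, v, y) \<in> S. even y}"
    by (simp add: S_def)
  have "x \<in> (\<lambda>k. real_of_int k / 2) ` {k. odd k}" if "x - 1 / 2 \<in> \<int>" for x :: real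
  proof -
    from that obtain k where "x - 1 / 2 = of_int k"
      by (rule Ints_cases)
    then show ?thesis by (intro image_eqI[of _ _ "2 * k + 1"]) (auto simp: field_simps)
  qed
  moreover have "real_of_int k / 2 - 1 / 2 \<in> \<int>" if "odd k" for k
    using that by (auto elim!: oddE simp: add_divide_distrib)
  ultimately have "half_odd = (\<lambda>k. real_of_int k / 2) ` {k. odd k}"
    by (auto simp: half_odd_def)
  from nontrivial_sym_configs_eq_image[OF this _ assms]
  have odd: "nontrivial_sym_configs half_odd H = config_of ` {(x, u, v, y) \<in> S. odd y}"
    by (simp add: S_def)
  have fin: "finite S"
    by (rule finite_subset[OF _ finite_signed_solutions[of "nat \<lfloor>2 * H\<rfloor>"]])
      (auto simp: S_def ordered_solutions_def signed_solutions_def)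
  have inj: "inj_on config_of T" if "T \<subseteq> S" for T
    using inj_on_config_of that unfolding S_def by (rule inj_on_subset)
  have "C_sym H = card {(x, u, v, y) \<in> S. even y} + card {(x, u, v, y) \<in> S. odd y}"
    unfolding C_sym_def even odd by (subst (1 2) card_image) (auto intro: inj)
  also have "\<dots> = card ({(x, u, v, y) \<in> S. even y} \<union> {(x, u, v, y) \<in> S. odd y})"
    using fin by (intro card_Un_disjoint[symmetric]) (auto intro: finite_subset)
  also have "{(x, u, v, y) \<in> S. even y} \<union> {(x, u, v, y) \<in> S. odd y} = S"
    by auto
  finally show ?thesis
    by (simp add: S_def)
qed

section \<open>Lattice points in a triangle\<close>

lemma real_div_le_of_nat_div: "real n / real k \<le> real (n div k) + 1"
  using floor_divide_of_nat_eq[where 'a = real, of n k] by linarith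

text \<open>The points are counted column by column. Rounding costs at most 1 in each of the
  \<open>M\<close> columns, and the sum of the unrounded column heights is compared with the
  area.\<close>

lemma card_triangle_lattice_points:
  fixes \<alpha> \<beta> N :: nat
  assumes "\<alpha> > 0" "\<beta> > 0"
  defines "T \<equiv> {(k, m). 0 < k \<and> 0 < m \<and> \<beta> * k + \<alpha> * m \<le> N}"
  shows "finite T" "\<bar>real (card T) - (real N)\<^sup>2 / (2 * \<alpha> * \<beta>)\<bar> \<le> N / (2 * \<alpha>) + N / \<beta>"
proof -
  define M where "M = N div \<beta>"
  have k_le: "k \<le> M \<longleftrightarrow> \<beta> * k \<le> N" for k
    using less_eq_div_iff_mult_less_eq[OF \<open>\<beta> > 0\<close>, of k N] by (simp add: M_def mult.commute)
  have T: "T = (SIGMA k:{1..M}. {1..(N - \<beta> * k) div \<alpha>})"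
  proof (intro set_eqI, clarify)
    fix k m
    have "m \<le> (N - \<beta> * k) div \<alpha> \<longleftrightarrow> \<alpha> * m \<le> N - \<beta> * k"
      using less_eq_div_iff_mult_less_eq[OF \<open>\<alpha> > 0\<close>] by (simp add: mult.commute)
    then show "(k, m) \<in> T \<longleftrightarrow> (k, m) \<in> (SIGMA k:{1..M}. {1..(N - \<beta> * k) div \<alpha>})"
      by (auto simp: T_def k_le)
  qed
  show "finite T"
    unfolding T by auto
  \<comment> \<open>The fractional part of \<open>N / \<beta>\<close>; it makes the gap between area
    and column sum explicit, and \<theta>^2 \<le> \<theta> bounds that gap.\<close>
  define \<theta> where "\<theta> = real N / \<beta> - M"
  have \<theta>: "0 \<le> \<theta>" "\<theta> \<le> 1"
    using of_nat_div_le_of_nat[where 'a = real, of N \<beta>] real_div_le_of_nat_div[of N \<beta>]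
    by (auto simp: \<theta>_def M_def)
  have N_eq: "real N = \<beta> * (M + \<theta>)"
    using assms by (simp add: \<theta>_def)
  have floor: "\<bar>real ((N - \<beta> * k) div \<alpha>) - (real N - \<beta> * k) / \<alpha>\<bar> \<le> 1" if "k \<in> {1..M}" for k
    using of_nat_div_le_of_nat[where 'a = real, of "N - \<beta> * k" \<alpha>]
      real_div_le_of_nat_div[of "N - \<beta> * k" \<alpha>] that
    by (simp add: k_le of_nat_diff abs_le_iff)
  define S where "S = (\<Sum>k=1..M. (real N - \<beta> * k) / \<alpha>)"
  define V where "V = (real N)\<^sup>2 / (2 * \<alpha> * \<beta>)"
  have "\<bar>real (card T) - S\<bar> = \<bar>\<Sum>k=1..M. real ((N - \<beta> * k) div \<alpha>) - (real N - \<beta> * k) / \<alpha>\<bar>"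
    by (simp add: T S_def sum_subtractf)
  also have "\<dots> \<le> (\<Sum>k=1..M. 1)"
    by (rule order_trans[OF sum_abs]) (intro sum_mono floor)
  also have "\<dots> \<le> N / \<beta>"
    using \<theta> by (simp add: \<theta>_def)
  finally have 1: "\<bar>real (card T) - S\<bar> \<le> N / \<beta>" .
  have "(\<Sum>k=1..M. real k) = M * (M + 1) / 2"
    by (induction M) (auto simp: field_simps)
  then have S_val: "S = (real N * M - \<beta> * (M * (M + 1) / 2)) / \<alpha>"
    by (simp add: S_def sum_subtractf flip: sum_divide_distrib sum_distrib_left)
  have S_eq: "V - S = \<beta> / \<alpha> * ((M + \<theta>\<^sup>2) / 2)"
    unfolding S_val V_def N_eq using \<open>\<alpha> > 0\<close> \<open>\<beta> > 0\<close> by (simp add: field_simps power2_eq_square)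
  also have "\<dots> \<le> \<beta> / \<alpha> * ((M + \<theta>) / 2)"
    using \<theta> by (intro mult_left_mono) (auto simp: power2_eq_square mult_left_le)
  also have "\<dots> = N / (2 * \<alpha>)"
    by (simp add: N_eq)
  finally have "V - S \<le> N / (2 * \<alpha>)" .
  moreover have "V - S \<ge> 0"
    unfolding S_eq by simp
  ultimately have "\<bar>real (card T) - V\<bar> \<le> N / (2 * \<alpha>) + N / \<beta>"
    using 1 unfolding abs_le_iff by linarith
  then show "\<bar>real (card T) - (real N)\<^sup>2 / (2 * \<alpha> * \<beta>)\<bar> \<le> N / (2 * \<alpha>) + N / \<beta>"
    unfolding V_def .
qed

definition line_pairs :: "nat \<Rightarrow> nat \<Rightarrow> nat \<Rightarrow> nat \<Rightarrow> (nat \<times> nat) set" where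
  "line_pairs q N s t = {(m, n). 0 < m \<and> m < n \<and> q dvd n - m \<and> m * s + n * t \<le> N}"

lemma card_line_pairs:
  fixes q s t N :: nat
  assumes "q > 0" "s < t"
  shows "finite (line_pairs q N s t)"
    and "\<bar>real (card (line_pairs q N s t)) - (real N)\<^sup>2 / (2 * q * (t * (real s + t)))\<bar> \<le> 2 * N / t"
proof -
  \<comment> \<open>The substitution \<open>n = m + q * k\<close> absorbs the congruence and turns
    the constraint into a triangle in \<open>(k, m)\<close>.\<close>
  define T where "T = {(k, m). 0 < k \<and> 0 < m \<and> q * t * k + (s + t) * m \<le> N}"
  have "(\<lambda>(k, m). (m, m + q * k)) ` T = line_pairs q N s t"
  proof (intro equalityI subsetI)
    fix p assume "p \<in> line_pairs q N s t"
    then obtain m n where p: "p = (m, n)" "0 < m" "m < n" "q dvd n - m" "m * s + n * t \<le> N"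
      by (auto simp: line_pairs_def)
    then obtain k where "n = m + q * k"
      by (metis dvdE le_add_diff_inverse less_imp_le)
    with p show "p \<in> (\<lambda>(k, m). (m, m + q * k)) ` T"
      by (intro image_eqI[of _ _ "(k, m)"]) (auto simp: T_def algebra_simps intro: gr0I)
  qed (use assms in \<open>auto simp: T_def line_pairs_def algebra_simps\<close>)
  moreover have "inj_on (\<lambda>(k, m). (m, m + q * k)) T"
    using assms by (auto simp: inj_on_def)
  ultimately have "bij_betw (\<lambda>(k, m). (m, m + q * k)) T (line_pairs q N s t)"
    by (simp add: bij_betw_def)
  note bij = bij_betw_same_card[OF this] bij_betw_finite[OF this]
  note tri = card_triangle_lattice_points[of "s + t" "q * t" N, folded T_def]
  show "finite (line_pairs q N s t)"
    using tri assms bij by simp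
  have "\<bar>real (card (line_pairs q N s t)) - (real N)\<^sup>2 / (2 * q * (t * (real s + t)))\<bar> =
      \<bar>real (card T) - (real N)\<^sup>2 / real (2 * (s + t) * (q * t))\<bar>"
    using bij by (simp add: mult_ac distrib_left)
  also have "\<dots> \<le> N / real (2 * (s + t)) + N / real (q * t)"
    using assms by (intro tri(2)) auto
  also have "\<dots> \<le> N / t + N / t"
    using assms by (intro add_mono divide_left_mono) (auto simp flip: of_nat_mult)
  also have "\<dots> = 2 * N / t"
    by simp
  finally show "\<bar>real (card (line_pairs q N s t)) - (real N)\<^sup>2 / (2 * q * (t * (real s + t)))\<bar> \<le> 2 * N / t" .
qed

section \<open>Sums over coprime pairs\<close>

text \<open>Comparison with the integral of \<open>1 / x\<close>, one step at a time: ln z \<le> z -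
  1 at \<open>(x + q) / x\<close> and at its reciprocal places each logarithmic increment between
  \<open>q / (x + q)\<close> and \<open>q / x\<close>. The excess in the upper bound is the
  telescoped difference of left and right endpoint values.\<close>

lemma sum_inverse_arith_progression:
  fixes a q :: real and n :: nat
  assumes "a > 0" "q > 0"
  shows "ln ((a + q * n) / a) / q \<le> (\<Sum>i<n. 1 / (a + q * i))"
    and "(\<Sum>i<n. 1 / (a + q * i)) \<le> ln ((a + q * n) / a) / q + 1 / a - 1 / (a + q * n)"
proof -
  have "ln ((a + q * n) / a) / q \<le> (\<Sum>i<n. 1 / (a + q * i)) \<and>
    (\<Sum>i<n. 1 / (a + q * i)) \<le> ln ((a + q * n) / a) / q + 1 / a - 1 / (a + q * n)"
  proof (induction n)
    case (Suc n)
    define x where "x = a + q * n"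
    have x: "x > 0" "x + q > 0"
      using assms by (simp_all add: x_def add_pos_nonneg add_pos_pos)
    have "ln ((x + q) / x) \<le> (x + q) / x - 1" "ln (x / (x + q)) \<le> x / (x + q) - 1"
      using x by (auto intro!: ln_le_minus_one divide_pos_pos)
    moreover have "ln (x / (x + q)) = - ln ((x + q) / x)"
      using x by (simp add: ln_div)
    moreover have "(x + q) / x - 1 = q / x" "x / (x + q) - 1 = - (q / (x + q))"
      using x by (simp_all add: field_simps)
    ultimately have "ln ((x + q) / x) \<le> q / x" "q / (x + q) \<le> ln ((x + q) / x)"
      by linarith+
    then have step: "ln ((x + q) / x) / q \<le> 1 / x" "1 / (x + q) \<le> ln ((x + q) / x) / q"
      using assms x by (simp_all add: field_simps)
    have "ln ((a + q * Suc n) / a) = ln (x / a) + ln ((x + q) / x)"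
      using assms x by (simp add: ln_div x_def algebra_simps)
    then have ln_eq: "ln ((a + q * Suc n) / a) / q = ln (x / a) / q + ln ((x + q) / x) / q"
      by (simp add: add_divide_distrib)
    have end_eq: "a + q * Suc n = x + q"
      by (simp add: x_def algebra_simps)
    have sum_eq: "(\<Sum>i<Suc n. 1 / (a + q * i)) = (\<Sum>i<n. 1 / (a + q * i)) + 1 / x"
      by (simp add: x_def)
    show ?case
      unfolding sum_eq ln_eq unfolding end_eq using Suc[folded x_def] step
      by linarith
  qed (use assms in auto)
  then show "ln ((a + q * n) / a) / q \<le> (\<Sum>i<n. 1 / (a + q * i))"
    "(\<Sum>i<n. 1 / (a + q * i)) \<le> ln ((a + q * n) / a) / q + 1 / a - 1 / (a + q * n)"
    by blast+
qed

section \<open>Harmonic sums over all integers and over odd integers\<close>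

definition coprimes_upto :: "nat \<Rightarrow> nat \<Rightarrow> nat set" where
  "coprimes_upto q N = {t. 0 < t \<and> t \<le> N \<and> coprime t q}"

lemma finite_coprimes_upto [simp]: "finite (coprimes_upto q N)"
  by (rule finite_subset[of _ "{..N}"]) (auto simp: coprimes_upto_def)

text \<open>For these two moduli the integers coprime to \<open>q\<close> form the single
  progression starting at 1 with step \<open>q\<close>; the number of terms is \<open>N / q\<close>
  rounded up.\<close>

lemma coprimes_upto_eq_image:
  assumes "q \<in> {1, 2}"
  shows "coprimes_upto q N = (\<lambda>j. 1 + q * j) ` {..<(N + q - 1) div q}"
proof -
  consider "q = 1" | "q = 2" using assms by auto
  then show ?thesis
  proof cases
    case 1
    have "t \<in> Suc ` {..<N}" if "0 < t" "t \<le> N" for t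
      using that by (intro image_eqI[of _ _ "t - 1"]) auto
    then show ?thesis
      using 1 by (auto simp: coprimes_upto_def)
  next
    case 2
    have "t \<in> (\<lambda>j. Suc (2 * j)) ` {..<Suc N div 2}" if "odd t" "t \<le> N" for t
      using that by (intro image_eqI[of _ _ "t div 2"]) (auto elim!: oddE)
    then show ?thesis
      using 2 by (auto simp: coprimes_upto_def odd_pos)
  qed
qed

lemma sum_coprimes_upto:
  assumes "q \<in> {1, 2}"
  shows "(\<Sum>t\<in>coprimes_upto q N. f t) = (\<Sum>j<(N + q - 1) div q. f (1 + q * j))"
  using assms by (auto simp: coprimes_upto_eq_image sum.reindex inj_on_def)

lemma sum_inverse_coprimes_upto:
  assumes q: "q \<in> {1, 2}" and N: "N > 0"
  shows "\<bar>(\<Sum>t\<in>coprimes_upto q N. 1 / real t) - ln N / q\<bar> \<le> 3"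
proof -
  define n where "n = (N + q - 1) div q"
  have n: "N \<le> q * n" "q * n \<le> N + 1"
    using q by (auto simp: n_def)
  have sum_eq: "(\<Sum>t\<in>coprimes_upto q N. 1 / real t) = (\<Sum>j<n. 1 / (1 + real q * real j))"
    using q by (simp add: sum_coprimes_upto n_def)
  have lower: "ln N \<le> ln (1 + real q * real n)"
    using n N by (subst ln_le_cancel_iff) (auto simp flip: of_nat_mult)
  \<comment> \<open>The progression ends at most at \<open>N + 2\<close>, hence at most at
    \<open>3 * N\<close>.\<close>
  have "ln (1 + real q * real n) \<le> ln (real N * 3)"
    using n N by (subst ln_le_cancel_iff) (auto simp flip: of_nat_mult intro: add_pos_nonneg)
  also have "\<dots> \<le> ln N + 2"
    using N ln_le_minus_one[of 3] by (simp add: ln_mult)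
  finally have "ln N / q \<le> ln (1 + real q * real n) / q" "ln (1 + real q * real n) / q \<le> ln N / q + 2 / q"
    using lower by (simp_all add: divide_right_mono flip: add_divide_distrib)
  moreover have "2 / q \<le> (2::real)" using q by auto
  moreover have "(\<Sum>j<n. 1 / (1 + real q * real j)) \<le> ln (1 + real q * real n) / q + 1"
    "ln (1 + real q * real n) / q \<le> (\<Sum>j<n. 1 / (1 + real q * real j))"
    using sum_inverse_arith_progression[of 1 "real q" n] q
    by (auto intro: order_trans simp: add_pos_nonneg)
  ultimately show ?thesis
    unfolding sum_eq by linarith
qed

text \<open>The denominators \<open>s + t\<close> run through a progression from
  \<open>t + 1\<close> up to, but excluding, \<open>2 * t\<close>. The logarithm of the ratio of
  these ends differs from \<open>ln 2\<close> by at most \<open>1 / t\<close>.\<close>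

lemma sum_inverse_add_coprimes_below:
  assumes q: "q \<in> {1, 2}" and t: "t > 0" "coprime t q"
  shows "\<bar>(\<Sum>s\<in>coprimes_upto q (t - 1). 1 / (real s + real t)) - ln 2 / q\<bar> \<le> 2 / t"
proof -
  define j where "j = (t - 1) div q"
  have j: "t = 1 + q * j"
    using q t by (auto simp: j_def odd_pos elim!: oddE)
  have "(t - 1 + q - 1) div q = j"
    using q by (auto simp: j)
  then have sum_eq: "(\<Sum>s\<in>coprimes_upto q (t - 1). 1 / (real s + real t)) =
      (\<Sum>i<j. 1 / ((real t + 1) + real q * real i))"
    using q by (subst sum_coprimes_upto) (simp_all add: algebra_simps)
  have end_eq: "(real t + 1) + real q * real j = 2 * real t"
    by (simp add: j)
  have pos: "real t + 1 > 0" "real q > 0"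
    using q by auto
  note progression = sum_inverse_arith_progression[OF pos, of j, unfolded end_eq]
  have bounds: "ln (2 * t / (t + 1)) / q \<le> (\<Sum>i<j. 1 / ((real t + 1) + real q * real i))"
    "(\<Sum>i<j. 1 / ((real t + 1) + real q * real i)) \<le> ln (2 * t / (t + 1)) / q + 1 / (real t + 1)"
    using progression(1) order_trans[OF progression(2)] by (simp_all add: add.commute)
  have "ln (real (t + 1) / t) \<le> real (t + 1) / t - 1"
    using t by (intro ln_le_minus_one) auto
  also have "\<dots> = 1 / t"
    using t by (simp add: field_simps)
  finally have "ln (real (t + 1) / t) \<le> 1 / t" .
  moreover have "ln (real (t + 1) / t) \<ge> 0"
    using t by (intro ln_ge_zero) auto
  moreover have "ln (2 * t / (t + 1)) = ln 2 - ln (real (t + 1) / t)"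
    using t by (simp add: ln_div ln_mult)
  ultimately have "ln (2 * t / (t + 1)) \<le> ln 2" "ln 2 - 1 / t \<le> ln (2 * t / (t + 1))"
    by linarith+
  then have "ln (2 * t / (t + 1)) / q \<le> ln 2 / q" "ln 2 / q - (1 / t) / q \<le> ln (2 * t / (t + 1)) / q"
    using divide_right_mono[of "ln 2 - 1 / t" _ "real q"]
    by (simp_all add: divide_right_mono diff_divide_distrib)
  moreover have "(1 / real t) / q \<le> 1 / t" "1 / (real t + 1) \<le> 1 / t"
    using q t by (auto simp: field_simps)
  ultimately show ?thesis
    unfolding sum_eq using bounds t by (simp add: abs_le_iff)
qed

lemma sum_inverse_squares_le:
  assumes "finite A" "0 \<notin> A"
  shows "(\<Sum>d\<in>A. 1 / (real d)\<^sup>2) \<le> pi\<^sup>2 / 6"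
proof -
  have sums: "(\<lambda>n. 1 / (real n + 1)\<^sup>2) sums (pi\<^sup>2 / 6)"
    using inverse_squares_sums by (simp add: add_ac)
  have "(\<Sum>d\<in>A. 1 / (real d)\<^sup>2) = (\<Sum>n\<in>(\<lambda>d. d - 1) ` A. 1 / (real n + 1)\<^sup>2)"
  proof (rule sum.reindex_bij_witness[of _ Suc "\<lambda>d. d - 1"])
    fix d assume "d \<in> A"
    then have "d > 0"
      using assms by (metis gr0I)
    then show "Suc (d - 1) = d" "1 / (real (d - 1) + 1)\<^sup>2 = 1 / (real d)\<^sup>2"
      by (simp_all add: of_nat_diff)
  next
    fix n assume "n \<in> (\<lambda>d. d - 1) ` A"
    then obtain d where "d \<in> A" "n = d - 1"
      by blast
    then show "Suc n \<in> A"
      using assms by (cases d) auto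
  qed auto
  also have "\<dots> \<le> pi\<^sup>2 / 6"
    unfolding sums_unique[OF sums] using assms by (intro sum_le_suminf sums_summable[OF sums]) auto
  finally show ?thesis .
qed

section \<open>Weighted sums over pairs and sorting by the gcd\<close>

definition pairs_upto :: "nat \<Rightarrow> nat \<Rightarrow> (nat \<times> nat) set" where
  "pairs_upto q N = {(s, t). 0 < s \<and> s < t \<and> t \<le> N \<and> coprime s q \<and> coprime t q}"

definition coprime_pairs_upto :: "nat \<Rightarrow> nat \<Rightarrow> (nat \<times> nat) set" where
  "coprime_pairs_upto q N = {(s, t) \<in> pairs_upto q N. coprime s t}"

text \<open>Multiplied by \<open>N^2 / (2 * q)\<close>, this is the area of the triangle counted by
  \<open>line_pairs q N s t\<close>.\<close>

definition pair_weight :: "nat \<times> nat \<Rightarrow> real" where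
  "pair_weight = (\<lambda>(s, t). 1 / (real t * (real s + real t)))"

lemma finite_pairs_upto [simp]: "finite (pairs_upto q N)"
  by (rule finite_subset[of _ "{..N} \<times> {..N}"]) (auto simp: pairs_upto_def)

lemma finite_coprime_pairs_upto [simp]: "finite (coprime_pairs_upto q N)"
  by (rule finite_subset[OF _ finite_pairs_upto]) (auto simp: coprime_pairs_upto_def)

lemma pair_weight_nonneg [simp]: "pair_weight p \<ge> 0"
  by (auto simp: pair_weight_def split: prod.splits)

lemma sum_pairs_upto:
  "(\<Sum>p\<in>pairs_upto q N. f p) = (\<Sum>t\<in>coprimes_upto q N. \<Sum>s\<in>coprimes_upto q (t - 1). f (s, t))"
  by (subst sum.Sigma, simp, simp, rule sum.reindex_bij_witness[of _ "\<lambda>(t, s). (s, t)" "\<lambda>(s, t). (t, s)"])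
     (auto simp: pairs_upto_def coprimes_upto_def)

text \<open>For fixed \<open>t\<close> the sum over \<open>s\<close> is
  \<open>ln 2 / q + O(1 / t)\<close>. The errors are summed against \<open>1 / t\<close> and
  converge, and the main term is a harmonic sum over \<open>t\<close>, which contributes a second
  factor \<open>1 / q\<close>.\<close>

lemma sum_pairs_weight:
  assumes q: "q \<in> {1, 2}" and N: "N > 0"
  shows "\<bar>(\<Sum>p\<in>pairs_upto q N. pair_weight p) - ln 2 / (real q)\<^sup>2 * ln N\<bar> \<le> pi\<^sup>2 / 3 + 3"
proof -
  let ?A = "coprimes_upto q N"
  define F where "F t = (\<Sum>s\<in>coprimes_upto q (t - 1). 1 / (real s + real t))" for t
  have "(\<Sum>p\<in>pairs_upto q N. pair_weight p) = (\<Sum>t\<in>?A. 1 / t * F t)"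
    by (simp add: sum_pairs_upto pair_weight_def F_def sum_distrib_left)
  then have "\<bar>(\<Sum>p\<in>pairs_upto q N. pair_weight p) - ln 2 / q * (\<Sum>t\<in>?A. 1 / t)\<bar>
      = \<bar>\<Sum>t\<in>?A. 1 / t * (F t - ln 2 / q)\<bar>"
    by (simp add: sum_distrib_left algebra_simps sum_subtractf)
  also have "\<dots> \<le> (\<Sum>t\<in>?A. \<bar>1 / t * (F t - ln 2 / q)\<bar>)"
    by (rule sum_abs)
  also have "\<dots> \<le> (\<Sum>t\<in>?A. 1 / t * (2 / t))"
    unfolding F_def abs_mult using q
    by (intro sum_mono mult_mono sum_inverse_add_coprimes_below) (auto simp: coprimes_upto_def)
  also have "\<dots> = 2 * (\<Sum>t\<in>?A. 1 / (real t)\<^sup>2)"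
    by (simp add: sum_distrib_left power2_eq_square)
  also have "\<dots> \<le> pi\<^sup>2 / 3"
    using sum_inverse_squares_le[of ?A] by (simp add: coprimes_upto_def)
  finally have 1: "\<bar>(\<Sum>p\<in>pairs_upto q N. pair_weight p) - ln 2 / q * (\<Sum>t\<in>?A. 1 / t)\<bar> \<le> pi\<^sup>2 / 3" .
  have "\<bar>ln 2 / q * (\<Sum>t\<in>?A. 1 / t) - ln 2 / (real q)\<^sup>2 * ln N\<bar> = ln 2 / q * \<bar>(\<Sum>t\<in>?A. 1 / t) - ln N / q\<bar>"
    by (subst abs_of_nonneg[of "ln 2 / q", symmetric])
      (simp_all only: flip: abs_mult, simp_all add: right_diff_distrib power2_eq_square)
  also have "\<dots> \<le> 1 * 3"
    using q ln_le_minus_one[of 2] by (intro mult_mono sum_inverse_coprimes_upto[OF q N]) auto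
  finally show ?thesis
    using 1 by linarith
qed

text \<open>Each pair is its gcd \<open>d\<close> times a coprime pair, and it is coprime to
  \<open>q\<close> entrywise exactly when \<open>d\<close> and the reduced entries are.\<close>

lemma bij_betw_scaled_coprime_pairs:
  "bij_betw (\<lambda>(d, s, t). (d * s, d * t))
     (SIGMA d:coprimes_upto q N. coprime_pairs_upto q (N div d)) (pairs_upto q N)"
proof (rule bij_betwI[where g = "\<lambda>(s, t). (gcd s t, s div gcd s t, t div gcd s t)"], goal_cases)
  case 1
  show ?case
    by (auto simp: coprimes_upto_def coprime_pairs_upto_def pairs_upto_def less_eq_div_iff_mult_less_eq mult.commute)
next
  case 2
  have "gcd s t \<le> N \<and> coprime (gcd s t) q \<and> s div gcd s t > 0 \<and> s div gcd s t < t div gcd s t \<and>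
      t div gcd s t \<le> N div gcd s t \<and> coprime (s div gcd s t) q \<and> coprime (t div gcd s t) q \<and>
      coprime (s div gcd s t) (t div gcd s t)"
    if st: "0 < s" "s < t" "t \<le> N" "coprime s q" "coprime t q" for s t
  proof -
    define g where "g = gcd s t"
    obtain s' t' where eq: "s = g * s'" "t = g * t'" "coprime s' t'"
      using st unfolding g_def by (metis gcd_coprime_exists mult.commute gr_implies_not0 gcd_eq_0_iff)
    have "g > 0" using st by (simp add: g_def)
    moreover have "g \<le> N" using st by (auto simp: g_def intro: order_trans[OF gcd_le2_nat])
    ultimately show ?thesis
      unfolding g_def[symmetric] using st
      by (auto simp: eq less_eq_div_iff_mult_less_eq mult.commute)
  qed
  then show ?case
    by (auto simp: coprimes_upto_def coprime_pairs_upto_def pairs_upto_def)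
next
  case (3 p)
  then show ?case
    by (auto simp: coprimes_upto_def coprime_pairs_upto_def gcd_mult_distrib_nat[symmetric])
next
  case (4 p)
  then show ?case
    by (auto simp: pairs_upto_def)
qed

text \<open>The weight is homogeneous of degree -2, so sorting by the gcd brings out the factor
  \<open>1 / d^2\<close>.\<close>

lemma sum_pairs_weight_eq:
  "(\<Sum>p\<in>pairs_upto q N. pair_weight p) =
     (\<Sum>d\<in>coprimes_upto q N. 1 / (real d)\<^sup>2 * (\<Sum>p\<in>coprime_pairs_upto q (N div d). pair_weight p))"
proof -
  have "(\<Sum>p\<in>pairs_upto q N. pair_weight p) =
      (\<Sum>(d, s, t)\<in>(SIGMA d:coprimes_upto q N. coprime_pairs_upto q (N div d)). pair_weight (d * s, d * t))"
    by (subst sum.reindex_bij_betw[OF bij_betw_scaled_coprime_pairs, symmetric]) (simp add: case_prod_unfold)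
  also have "\<dots> = (\<Sum>d\<in>coprimes_upto q N. \<Sum>(s, t)\<in>coprime_pairs_upto q (N div d). pair_weight (d * s, d * t))"
    by (simp add: sum.Sigma case_prod_unfold)
  also have "\<dots> = (\<Sum>d\<in>coprimes_upto q N. 1 / (real d)\<^sup>2 * (\<Sum>p\<in>coprime_pairs_upto q (N div d). pair_weight p))"
  proof (intro sum.cong refl)
    fix d
    have "pair_weight (d * s, d * t) = 1 / (real d)\<^sup>2 * pair_weight (s, t)" for s t
    proof -
      have "real (d * t) * (real (d * s) + real (d * t)) = (real d)\<^sup>2 * (real t * (real s + real t))"
        by (simp add: power2_eq_square algebra_simps)
      then show ?thesis
        by (simp add: pair_weight_def)
    qed
    then show "(\<Sum>(s, t)\<in>coprime_pairs_upto q (N div d). pair_weight (d * s, d * t)) =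
        1 / (real d)\<^sup>2 * (\<Sum>p\<in>coprime_pairs_upto q (N div d). pair_weight p)"
      by (simp only: sum_distrib_left case_prod_unfold prod.collapse)
  qed
  finally show ?thesis .
qed

text \<open>Each \<open>t\<close> between \<open>M\<close> and \<open>N\<close> has fewer than
  \<open>t\<close> partners, each of weight at most \<open>1 / t^2\<close>; what remains is a piece
  of the harmonic series.\<close>

lemma sum_weight_between_le:
  assumes "0 < M" "M \<le> N"
  shows "(\<Sum>p\<in>coprime_pairs_upto q N. pair_weight p) - (\<Sum>p\<in>coprime_pairs_upto q M. pair_weight p)
    \<le> ln (N / M)"
proof -
  have sub: "coprime_pairs_upto q M \<subseteq> coprime_pairs_upto q N"
    using assms by (auto simp: coprime_pairs_upto_def pairs_upto_def)
  have "(\<Sum>p\<in>coprime_pairs_upto q N. pair_weight p) - (\<Sum>p\<in>coprime_pairs_upto q M. pair_weight p)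
      = (\<Sum>p\<in>coprime_pairs_upto q N - coprime_pairs_upto q M. pair_weight p)"
    using sub by (simp add: sum_diff)
  also have "\<dots> \<le> (\<Sum>p\<in>(\<lambda>(t, s). (s, t)) ` (SIGMA t:{M<..N}. {0<..<t}). pair_weight p)"
    by (intro sum_mono2) (auto simp: coprime_pairs_upto_def pairs_upto_def image_iff)
  also have "\<dots> = (\<Sum>t\<in>{M<..N}. \<Sum>s\<in>{0<..<t}. pair_weight (s, t))"
    by (subst sum.reindex) (auto simp: inj_on_def sum.Sigma case_prod_unfold)
  also have "\<dots> \<le> (\<Sum>t\<in>{M<..N}. 1 / real t)"
  proof (intro sum_mono)
    fix t assume t: "t \<in> {M<..N}"
    have "(\<Sum>s\<in>{0<..<t}. pair_weight (s, t)) \<le> (\<Sum>s\<in>{0<..<t}. 1 / (real t * real t))"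
      using t by (intro sum_mono) (auto simp: pair_weight_def intro!: divide_left_mono mult_left_mono)
    also have "\<dots> \<le> 1 / real t"
      using t by (simp add: field_simps)
    finally show "(\<Sum>s\<in>{0<..<t}. pair_weight (s, t)) \<le> 1 / real t" .
  qed
  also have "\<dots> = (\<Sum>i<N - M. 1 / (real M + 1 * real (Suc i)))"
    by (rule sum.reindex_bij_witness[of _ "\<lambda>i. M + Suc i" "\<lambda>t. t - M - 1"]) (use assms in auto)
  \<comment> \<open>Shifting the index to start at \<open>M\<close> trades the term at
    \<open>N\<close> for the one at \<open>M\<close>, which cancels the endpoint correction of the
    upper bound exactly.\<close>
  also have "\<dots> = (\<Sum>i<Suc (N - M). 1 / (real M + 1 * real i)) - 1 / M"
    by (subst sum.lessThan_Suc_shift) simp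
  also have "\<dots> = (\<Sum>i<N - M. 1 / (real M + 1 * real i)) + 1 / N - 1 / M"
    using assms by (simp add: of_nat_diff)
  also have "\<dots> \<le> ln (N / M)"
    using sum_inverse_arith_progression(2)[of "real M" 1 "N - M"] assms by (simp add: of_nat_diff)
  finally show ?thesis .
qed

lemma sum_coprime_pairs_weight_le:
  "(\<Sum>p\<in>coprime_pairs_upto q N. pair_weight p) \<le> N"
proof (cases "N = 0")
  case False
  have "coprime_pairs_upto q 1 = {}"
    by (auto simp: coprime_pairs_upto_def pairs_upto_def)
  then show ?thesis
    using sum_weight_between_le[of 1 N q] False ln_le_minus_one[of "real N"] by simp
qed (auto simp: coprime_pairs_upto_def pairs_upto_def intro!: sum_nonpos)

section \<open>The series of 1/d^2 over d coprime to q: values and tail\<close>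

definition coprime_zeta2 :: "nat \<Rightarrow> real" where
  "coprime_zeta2 q = (\<Sum>n. if coprime (Suc n) q then 1 / (real (Suc n))\<^sup>2 else 0)"

lemma summable_coprime_zeta2:
  "summable (\<lambda>n. if coprime (Suc n) q then 1 / (real (Suc n))\<^sup>2 else 0 :: real)"
  by (rule summable_comparison_test'[OF sums_summable[OF inverse_squares_sums], of 0]) auto

lemma coprime_zeta2_1: "coprime_zeta2 1 = pi\<^sup>2 / 6"
  using sums_unique[OF inverse_squares_sums] by (simp add: coprime_zeta2_def)

text \<open>The even terms add up to a quarter of the full series, leaving three quarters of
  \<open>pi^2 / 6\<close>.\<close>

lemma coprime_zeta2_2: "coprime_zeta2 2 = pi\<^sup>2 / 8"
proof -
  let ?f = "\<lambda>n. 1 / (real (Suc n))\<^sup>2"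
  let ?e = "\<lambda>n. if odd (Suc n) then 0 else ?f n"
  have "(\<lambda>n. ?f n / 4) sums (pi\<^sup>2 / 6 / 4)"
    by (intro sums_divide) (use inverse_squares_sums in simp)
  also have "(\<lambda>n. ?f n / 4) = (\<lambda>n. ?e (2 * n + 1))"
    by (auto simp: fun_eq_iff power2_eq_square field_simps)
  \<comment> \<open>Index \<open>n\<close> stands for the integer \<open>n + 1\<close>, so the even
    integers sit at the indices \<open>2 * n + 1\<close>.\<close>
  also have "\<dots> sums (pi\<^sup>2 / 6 / 4) \<longleftrightarrow> ?e sums (pi\<^sup>2 / 6 / 4)"
    by (rule sums_mono_reindex) (auto simp: strict_mono_def image_iff, metis oddE Suc_eq_plus1)
  finally have "(\<lambda>n. ?f n - ?e n) sums (pi\<^sup>2 / 6 - pi\<^sup>2 / 6 / 4)"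
    by (intro sums_diff) (use inverse_squares_sums in simp_all)
  also have "(\<lambda>n. ?f n - ?e n) = (\<lambda>n. if coprime (Suc n) 2 then ?f n else 0)"
    by (auto simp: fun_eq_iff)
  finally show ?thesis
    unfolding coprime_zeta2_def by (simp add: sums_iff)
qed

lemma coprime_zeta2_tail:
  assumes "N > 0"
  shows "(\<Sum>d\<in>coprimes_upto q N. 1 / (real d)\<^sup>2) \<le> coprime_zeta2 q"
    and "coprime_zeta2 q - (\<Sum>d\<in>coprimes_upto q N. 1 / (real d)\<^sup>2) \<le> 1 / N"
proof -
  let ?g = "\<lambda>n. if coprime (Suc n) q then 1 / (real (Suc n))\<^sup>2 else 0"
  have eq: "(\<Sum>d\<in>coprimes_upto q M. 1 / (real d)\<^sup>2) = (\<Sum>n<M. ?g n)" for M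
  proof -
    have "(\<Sum>n<M. ?g n) = (\<Sum>n | n < M \<and> coprime (Suc n) q. 1 / (real (Suc n))\<^sup>2)"
      by (subst sum.If_cases) (auto intro!: sum.cong)
    also have "\<dots> = (\<Sum>d\<in>coprimes_upto q M. 1 / (real d)\<^sup>2)"
      by (rule sum.reindex_bij_witness[of _ "\<lambda>d. d - 1" Suc]) (auto simp: coprimes_upto_def)
    finally show ?thesis ..
  qed
  show "(\<Sum>d\<in>coprimes_upto q N. 1 / (real d)\<^sup>2) \<le> coprime_zeta2 q"
    unfolding eq coprime_zeta2_def using summable_coprime_zeta2 by (intro sum_le_suminf) auto
  \<comment> \<open>The subtracted \<open>1 / (N + k)\<close> makes the induction telescope.\<close>
  have "(\<Sum>n<N + k. ?g n) \<le> (\<Sum>n<N. ?g n) + 1 / N - 1 / (N + k)" for k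
  proof (induction k)
    case (Suc k)
    define x where "x = real (N + k)"
    have x: "x > 0" using assms by (simp add: x_def)
    have "?g (N + k) \<le> 1 / (x + 1)\<^sup>2"
      by (simp add: x_def add_ac)
    also have "\<dots> \<le> 1 / (x * (x + 1))"
      using x by (intro divide_left_mono) (auto simp: power2_eq_square)
    also have "\<dots> = 1 / x - 1 / (x + 1)"
      using x by (simp add: field_simps)
    finally show ?case
      using Suc by (simp add: x_def add_ac)
  qed (use assms in auto)
  then have "(\<Sum>n<N + k. ?g n) \<le> (\<Sum>n<N. ?g n) + 1 / N" for k
    by (smt (verit) divide_nonneg_nonneg of_nat_0_le_iff)
  then have "\<forall>M\<ge>N. (\<Sum>n<M. ?g n) \<le> (\<Sum>n<N. ?g n) + 1 / N"
    by (auto simp only: le_iff_add)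
  then have "coprime_zeta2 q \<le> (\<Sum>n<N. ?g n) + 1 / N"
    unfolding coprime_zeta2_def
    by (intro LIMSEQ_le_const2[OF summable_LIMSEQ[OF summable_coprime_zeta2]] exI[of _ N])
  then show "coprime_zeta2 q - (\<Sum>d\<in>coprimes_upto q N. 1 / (real d)\<^sup>2) \<le> 1 / N"
    unfolding eq by simp
qed

text \<open>Write \<open>K\<close> for the sum over all pairs. Replacing each
  \<open>P (N div d)\<close> in the gcd decomposition of \<open>K\<close> by \<open>P N\<close>
  costs a convergent sum, and completing the sum over \<open>d\<close> to \<open>z\<close> costs at
  most 1. Hence \<open>z * P N\<close> equals \<open>K\<close> up to a bounded error.\<close>

lemma sum_coprime_pairs_weight_asymp:
  assumes q: "q \<in> {1, 2}"
  shows "\<exists>B. \<forall>N>0. \<bar>(\<Sum>p\<in>coprime_pairs_upto q N. pair_weight p) -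
    ln 2 / ((real q)\<^sup>2 * coprime_zeta2 q) * ln N\<bar> \<le> B"
proof -
  let ?A = "coprimes_upto q"
  define P where "P N = (\<Sum>p\<in>coprime_pairs_upto q N. pair_weight p)" for N
  define z where "z = coprime_zeta2 q"
  have "z \<ge> 1"
  proof -
    have "?A 1 = {1}"
      by (auto simp: coprimes_upto_def)
    then show ?thesis
      using coprime_zeta2_tail(1)[of 1 q] by (simp add: z_def)
  qed
  have summable: "summable (\<lambda>d. 4 * real d powr (- (3 / 2)))"
    by (intro summable_mult) (simp add: summable_real_powr_iff)
  define S where "S = (\<Sum>d. 4 * real d powr (- (3 / 2)))"
  have P_nonneg: "P N \<ge> 0" for N
    by (simp add: P_def sum_nonneg)
  have drop: "0 \<le> P N - P (N div d)" "1 / (real d)\<^sup>2 * (P N - P (N div d)) \<le> 4 * real d powr (- (3 / 2))"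
    if d: "d \<in> ?A N" for N d
  proof -
    have d: "d > 0" "d \<le> N" using d by (auto simp: coprimes_upto_def)
    define M where "M = N div d"
    \<comment> \<open>Since \<open>M\<close> is positive, rounding down loses at most a factor 2, so
      \<open>N / M\<close> is at most \<open>2 * d\<close>.\<close>
    have "N < d * Suc M"
      using d by (auto simp: M_def dividend_less_times_div)
    moreover have M: "M > 0" "M \<le> N"
      using d by (auto simp: M_def div_greater_zero_iff)
    moreover have "d * Suc M \<le> d * (2 * M)"
      using M by (intro mult_le_mono2) auto
    ultimately have "N \<le> 2 * d * M"
      by linarith
    then have "real N \<le> real (2 * d * M)"
      by (simp only: of_nat_le_iff)
    then have "real N / M \<le> 2 * d"
      using M by (simp add: field_simps)
    moreover have "real N / M > 0"
      using M d by simp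
    ultimately have "ln (real N / M) \<le> ln (2 * d)"
      by simp
    \<comment> \<open>Bounding the logarithm by a square root keeps the majorant summable, with
      exponent -3/2.\<close>
    also have "\<dots> = 2 * ln (sqrt (2 * d))"
      using d by (simp add: ln_sqrt)
    also have "\<dots> \<le> 2 * sqrt (2 * d)"
      using d ln_le_minus_one[of "sqrt (2 * d)"] by simp
    also have "\<dots> \<le> 4 * sqrt d"
      using sqrt2_less_2 mult_left_mono[of "sqrt 2" 2 "sqrt d"] by (simp add: real_sqrt_mult mult.commute)
    finally have ln_le: "ln (real N / M) \<le> 4 * sqrt d" .
    have "coprime_pairs_upto q M \<subseteq> coprime_pairs_upto q N"
      using M by (auto simp: coprime_pairs_upto_def pairs_upto_def)
    then show "0 \<le> P N - P (N div d)"
      unfolding P_def M_def[symmetric] by (simp add: sum_mono2)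
    have "1 / (real d)\<^sup>2 * (P N - P M) \<le> 1 / (real d)\<^sup>2 * (4 * sqrt d)"
      using sum_weight_between_le[OF M, of q] ln_le
      by (intro mult_left_mono) (auto simp: P_def)
    also have "\<dots> = 4 * (real d powr (1 / 2) / real d powr 2)"
      using d by (simp add: powr_half_sqrt powr_numeral)
    also have "\<dots> = 4 * real d powr (- (3 / 2))"
      unfolding powr_diff[symmetric] by simp
    finally show "1 / (real d)\<^sup>2 * (P N - P (N div d)) \<le> 4 * real d powr (- (3 / 2))"
      unfolding M_def .
  qed
  have "\<bar>P N - ln 2 / ((real q)\<^sup>2 * z) * ln N\<bar> \<le> S + 1 + (pi\<^sup>2 / 3 + 3)" if N: "N > 0" for N
  proof -
    let ?K = "\<Sum>p\<in>pairs_upto q N. pair_weight p"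
    have "P N * (\<Sum>d\<in>?A N. 1 / (real d)\<^sup>2) - ?K = (\<Sum>d\<in>?A N. 1 / (real d)\<^sup>2 * (P N - P (N div d)))"
      unfolding sum_pairs_weight_eq P_def[symmetric]
      by (simp add: sum_distrib_left algebra_simps diff_divide_distrib flip: sum_subtractf)
    moreover have "\<dots> \<ge> 0"
      using drop(1) by (intro sum_nonneg mult_nonneg_nonneg) auto
    moreover have "(\<Sum>d\<in>?A N. 1 / (real d)\<^sup>2 * (P N - P (N div d))) \<le> (\<Sum>d\<in>?A N. 4 * real d powr (- (3 / 2)))"
      using drop(2) by (intro sum_mono)
    moreover have "\<dots> \<le> S"
      unfolding S_def by (intro sum_le_suminf summable) auto
    moreover have "0 \<le> P N * (z - (\<Sum>d\<in>?A N. 1 / (real d)\<^sup>2))"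
      using coprime_zeta2_tail(1)[OF N, of q] P_nonneg by (simp add: z_def)
    \<comment> \<open>The crude bound \<open>N\<close> for \<open>P N\<close> meets a tail of size
      at most \<open>1 / N\<close>.\<close>
    moreover have "P N * (z - (\<Sum>d\<in>?A N. 1 / (real d)\<^sup>2)) \<le> N * (1 / N)"
      unfolding z_def P_def by (intro mult_mono sum_coprime_pairs_weight_le coprime_zeta2_tail N)
        (use coprime_zeta2_tail(1)[OF N, of q] in auto)
    moreover have "real N * (1 / N) = 1"
      using N by simp
    moreover have "P N * (z - (\<Sum>d\<in>?A N. 1 / (real d)\<^sup>2)) = z * P N - P N * (\<Sum>d\<in>?A N. 1 / (real d)\<^sup>2)"
      by (simp add: algebra_simps)
    ultimately have "\<bar>z * P N - ?K\<bar> \<le> S + 1"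
      by linarith
    then have bound: "\<bar>z * P N - ln 2 / (real q)\<^sup>2 * ln N\<bar> \<le> S + 1 + (pi\<^sup>2 / 3 + 3)"
      using sum_pairs_weight[OF q N] by linarith
    define W where "W = P N - ln 2 / ((real q)\<^sup>2 * z) * ln N"
    have "z * P N - ln 2 / (real q)\<^sup>2 * ln N = z * W"
      using \<open>z \<ge> 1\<close> q by (auto simp: W_def field_simps)
    moreover have "\<bar>z * W\<bar> = z * \<bar>W\<bar>"
      using \<open>z \<ge> 1\<close> by (simp add: abs_mult)
    moreover have "1 * \<bar>W\<bar> \<le> z * \<bar>W\<bar>"
      using \<open>z \<ge> 1\<close> by (intro mult_right_mono) auto
    ultimately have "\<bar>W\<bar> \<le> S + 1 + (pi\<^sup>2 / 3 + 3)"
      using bound by simp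
    then show ?thesis
      unfolding W_def .
  qed
  then show ?thesis
    unfolding P_def z_def by blast
qed

section \<open>The asymptotic formula\<close>

text \<open>Coprime \<open>s\<close> and \<open>t\<close> are never both even, so they have equal
  parity only when both are odd. In that case \<open>m\<close> and \<open>n\<close> are
  unrestricted; otherwise they must be congruent modulo 2.\<close>

lemma mem_prim_quads_iff:
  "(m, n, s, t) \<in> prim_quads N \<longleftrightarrow> (s, t) \<in> coprime_pairs_upto 1 N \<and>
     (m, n) \<in> line_pairs (if odd s \<and> odd t then 1 else 2) N s t"
proof -
  have "t \<le> N" if "m < n" "m * s + n * t \<le> N"
  proof -
    have "1 * t \<le> n * t"
      using that by (intro mult_le_mono1) auto
    then show ?thesis
      using that by linarith
  qed
  moreover have "(if odd s \<and> odd t then 1 else 2) dvd n - m \<longleftrightarrow> even m = even n \<or> even s = even t"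
    if "m < n" "coprime s t"
  proof -
    have "\<not> (even s \<and> even t)"
      using that(2) coprime_common_divisor_nat[of s t 2] by auto
    then show ?thesis
      using that(1) by auto
  qed
  ultimately show ?thesis
    unfolding prim_quads_def coprime_pairs_upto_def pairs_upto_def line_pairs_def
      mem_Collect_eq prod.case
    using coprime_1_right[of s] coprime_1_right[of t] by blast
qed

lemma bij_betw_prim_quads:
  "bij_betw (\<lambda>(m, n, s, t). ((s, t), (m, n))) (prim_quads N)
     (SIGMA (s, t):coprime_pairs_upto 1 N. line_pairs (if odd s \<and> odd t then 1 else 2) N s t)"
  by (rule bij_betwI[where g = "\<lambda>((s, t), (m, n)). (m, n, s, t)"])
    (auto simp: mem_prim_quads_iff simp del: One_nat_def)

lemma card_prim_quads:
  "\<bar>real (card (prim_quads N)) - (real N)\<^sup>2 / 4 * ((\<Sum>p\<in>coprime_pairs_upto 1 N. pair_weight p) +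
     (\<Sum>p\<in>coprime_pairs_upto 2 N. pair_weight p))\<bar> \<le> 2 * (real N)\<^sup>2"
proof -
  let ?q = "\<lambda>(s, t). if odd s \<and> odd t then 1 else 2 :: nat"
  let ?P = "coprime_pairs_upto 1 N"
  define L where "L = (\<lambda>(s, t). line_pairs (?q (s, t)) N s t)"
  have L: "finite (L p)" "\<bar>real (card (L p)) - (real N)\<^sup>2 / 2 * (pair_weight p / ?q p)\<bar> \<le> 2 * N / snd p"
    if "p \<in> ?P" for p
    using card_line_pairs[of "?q p" "fst p" "snd p" N] that
    by (auto simp: L_def coprime_pairs_upto_def pairs_upto_def pair_weight_def mult_ac)
  have "card (prim_quads N) = card (SIGMA p:?P. L p)"
    using bij_betw_same_card[OF bij_betw_prim_quads] by (simp add: L_def case_prod_unfold)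
  also have "\<dots> = (\<Sum>p\<in>?P. card (L p))"
    using L(1) by simp
  finally have card_eq: "real (card (prim_quads N)) = (\<Sum>p\<in>?P. real (card (L p)))"
    by simp
  have card_1: "card (coprimes_upto 1 M) = M" for M
  proof -
    have "coprimes_upto 1 M = {1..M}"
      by (auto simp: coprimes_upto_def)
    then show ?thesis
      by simp
  qed
  have odd_pairs: "coprime_pairs_upto 2 N = {p \<in> ?P. odd (fst p) \<and> odd (snd p)}"
    by (auto simp: coprime_pairs_upto_def pairs_upto_def)
  have "(\<Sum>p\<in>coprime_pairs_upto 2 N. pair_weight p) = (\<Sum>p\<in>?P. if odd (fst p) \<and> odd (snd p) then pair_weight p else 0)"
    unfolding odd_pairs by (simp add: sum.inter_filter)
  \<comment> \<open>The factor \<open>1 / q\<close> is 1/2 for every pair plus a further 1/2 for the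
    odd pairs.\<close>
  then have "(\<Sum>p\<in>?P. pair_weight p) + (\<Sum>p\<in>coprime_pairs_upto 2 N. pair_weight p) =
      (\<Sum>p\<in>?P. 2 * (pair_weight p / ?q p))"
    by (simp add: case_prod_unfold flip: sum.distrib) (intro sum.cong, auto)
  then have "(real N)\<^sup>2 / 4 * ((\<Sum>p\<in>?P. pair_weight p) + (\<Sum>p\<in>coprime_pairs_upto 2 N. pair_weight p)) =
      (\<Sum>p\<in>?P. (real N)\<^sup>2 / 2 * (pair_weight p / ?q p))"
    by (simp add: sum_distrib_left mult_ac)
  then have "\<bar>real (card (prim_quads N)) - (real N)\<^sup>2 / 4 * ((\<Sum>p\<in>?P. pair_weight p) +
      (\<Sum>p\<in>coprime_pairs_upto 2 N. pair_weight p))\<bar> =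
      \<bar>\<Sum>p\<in>?P. real (card (L p)) - (real N)\<^sup>2 / 2 * (pair_weight p / ?q p)\<bar>"
    unfolding card_eq by (simp only: sum_subtractf)
  also have "\<dots> \<le> (\<Sum>p\<in>?P. 2 * N / snd p)"
    using L(2) by (intro order_trans[OF sum_abs sum_mono]) auto
  also have "\<dots> \<le> (\<Sum>p\<in>pairs_upto 1 N. 2 * N / snd p)"
    by (intro sum_mono2) (auto simp: coprime_pairs_upto_def)
  \<comment> \<open>Fewer than \<open>t\<close> values of \<open>s\<close> belong to each
    \<open>t\<close>, so each \<open>t\<close> contributes at most \<open>2 * N\<close> to the
    error.\<close>
  also have "\<dots> = (\<Sum>t\<in>coprimes_upto 1 N. card (coprimes_upto 1 (t - 1)) * (2 * N / t))"
    by (simp add: sum_pairs_upto)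
  also have "\<dots> \<le> (\<Sum>t\<in>coprimes_upto 1 N. 2 * real N)"
  proof (intro sum_mono)
    fix t assume t: "t \<in> coprimes_upto 1 N"
    have "real (t - 1) * (2 * N / t) \<le> real t * (2 * N / t)"
      by (intro mult_right_mono) auto
    also have "\<dots> = 2 * real N"
      using t by (simp add: coprimes_upto_def)
    finally show "card (coprimes_upto 1 (t - 1)) * (2 * N / t) \<le> 2 * real N"
      by (simp only: card_1)
  qed
  also have "\<dots> = N * (2 * real N)"
    by (simp only: sum_constant card_1)
  also have "\<dots> = 2 * (real N)\<^sup>2"
    by (simp add: power2_eq_square)
  finally show ?thesis .
qed

text \<open>The zeta values \<open>pi^2 / 6\<close> and \<open>pi^2 / 8\<close> give the
  coefficients 6 and 2 of \<open>ln 2 / pi^2\<close>; their sum 8 is divided by 4.\<close>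

lemma card_prim_quads_asymp:
  "\<exists>B. \<forall>N>0. \<bar>real (card (prim_quads N)) - 2 * ln 2 / pi\<^sup>2 * (real N)\<^sup>2 * ln N\<bar> \<le> B * (real N)\<^sup>2"
proof -
  define P where "P q N = (\<Sum>p\<in>coprime_pairs_upto q N. pair_weight p)" for q N
  obtain B1 where B1: "\<bar>P 1 N - 6 * ln 2 / pi\<^sup>2 * ln N\<bar> \<le> B1" if "N > 0" for N
    using sum_coprime_pairs_weight_asymp[of 1, unfolded coprime_zeta2_1] by (auto simp: P_def mult.commute)
  obtain B2 where B2: "\<bar>P 2 N - 2 * ln 2 / pi\<^sup>2 * ln N\<bar> \<le> B2" if "N > 0" for N
    using sum_coprime_pairs_weight_asymp[of 2] by (auto simp: P_def coprime_zeta2_2 mult.commute)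
  have "\<bar>real (card (prim_quads N)) - 2 * ln 2 / pi\<^sup>2 * (real N)\<^sup>2 * ln N\<bar> \<le> (2 + (B1 + B2) / 4) * (real N)\<^sup>2"
    if N: "N > 0" for N
  proof -
    define c where "c = ln 2 / pi\<^sup>2 * ln N"
    have "\<bar>P 1 N - 6 * c\<bar> \<le> B1" "\<bar>P 2 N - 2 * c\<bar> \<le> B2"
      using B1[OF N] B2[OF N] by (simp_all add: c_def)
    then have "\<bar>(P 1 N + P 2 N) - 8 * c\<bar> \<le> B1 + B2"
      by linarith
    then have "(real N)\<^sup>2 / 4 * \<bar>(P 1 N + P 2 N) - 8 * c\<bar> \<le> (real N)\<^sup>2 / 4 * (B1 + B2)"
      by (intro mult_left_mono) auto
    moreover have "(real N)\<^sup>2 / 4 * \<bar>(P 1 N + P 2 N) - 8 * c\<bar> =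
        \<bar>(real N)\<^sup>2 / 4 * ((P 1 N + P 2 N) - 8 * c)\<bar>"
      by (simp add: abs_mult)
    moreover have "(real N)\<^sup>2 / 4 * ((P 1 N + P 2 N) - 8 * c) =
        (real N)\<^sup>2 / 4 * (P 1 N + P 2 N) - 2 * (real N)\<^sup>2 * c"
      by (simp add: algebra_simps)
    moreover have "\<bar>real (card (prim_quads N)) - (real N)\<^sup>2 / 4 * (P 1 N + P 2 N)\<bar> \<le> 2 * (real N)\<^sup>2"
      using card_prim_quads[of N] by (simp add: P_def)
    moreover have "2 * ln 2 / pi\<^sup>2 * (real N)\<^sup>2 * ln N = 2 * (real N)\<^sup>2 * c"
      by (simp add: c_def)
    moreover have "(2 + (B1 + B2) / 4) * (real N)\<^sup>2 = 2 * (real N)\<^sup>2 + (real N)\<^sup>2 / 4 * (B1 + B2)"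
      by (simp add: algebra_simps)
    ultimately show ?thesis
      by linarith
  qed
  then show ?thesis
    by blast
qed

lemma square_ln_floor_le:
  fixes x :: real
  assumes "x \<ge> 1"
  defines "N \<equiv> real (nat \<lfloor>x\<rfloor>)"
  shows "1 \<le> N" "N \<le> x" "\<bar>N\<^sup>2 * ln N - x\<^sup>2 * ln x\<bar> \<le> 3 * x\<^sup>2"
proof -
  show N: "1 \<le> N" "N \<le> x"
    using assms(1) by (simp_all add: N_def le_nat_iff le_floor_iff)
  have "x \<le> N + 1"
    unfolding N_def using assms(1) by linarith
  have ln: "0 \<le> ln N" "ln N \<le> ln x" "ln x \<le> x"
    using N ln_le_minus_one[of x] by auto
  have "N\<^sup>2 \<le> x\<^sup>2"
    using N by (intro power_mono) auto
  then have "N\<^sup>2 * ln N \<le> x\<^sup>2 * ln x"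
    using ln by (intro mult_mono) auto
  \<comment> \<open>The change of the square and that of the logarithm are separated; the first is
    bounded using ln x \<le> x, the second using ln z \<le> z - 1 at \<open>x / N\<close>.\<close>
  moreover have "x\<^sup>2 * ln x - N\<^sup>2 * ln N = (x - N) * (x + N) * ln x + N\<^sup>2 * (ln x - ln N)"
    by (simp add: power2_eq_square algebra_simps)
  moreover have "(x - N) * (x + N) * ln x \<le> 1 * (2 * x) * x"
    using N ln \<open>x \<le> N + 1\<close> by (intro mult_mono) auto
  moreover have "ln x - ln N \<le> x / N - 1"
    using N ln_le_minus_one[of "x / N"] by (simp add: ln_div)
  then have "ln x - ln N \<le> 1 / N"
    using N \<open>x \<le> N + 1\<close> by (simp add: field_simps)
  then have "N\<^sup>2 * (ln x - ln N) \<le> N\<^sup>2 * (1 / N)"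
    by (intro mult_left_mono) auto
  moreover have "N\<^sup>2 * (1 / N) \<le> N * N"
    using N by (simp add: power2_eq_square)
  moreover have "N * N \<le> x * x"
    using N by (intro mult_mono) auto
  ultimately show "\<bar>N\<^sup>2 * ln N - x\<^sup>2 * ln x\<bar> \<le> 3 * x\<^sup>2"
    unfolding abs_le_iff power2_eq_square by linarith
qed

theorem theorem4p7:
  shows "(\<lambda>H::real. real (C_sym H) - 2 * ln 2 / pi\<^sup>2 * H\<^sup>2 * ln H) \<in> O[at_top](\<lambda>H. H\<^sup>2)"
proof -
  obtain B where B: "\<bar>real (card (prim_quads N)) - 2 * ln 2 / pi\<^sup>2 * (real N)\<^sup>2 * ln N\<bar> \<le> B * (real N)\<^sup>2"
    if "N > 0" for N
    using card_prim_quads_asymp by auto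
  define c where "c = 2 * ln 2 / pi\<^sup>2"
  have c: "c \<ge> 0"
    by (simp add: c_def)
  show ?thesis
  proof (rule bigoI)
    \<comment> \<open>With \<open>x = 2 * H\<close>, 72 is 8 times the 9 from (2n + 1)^2 \<le> 9
      x^2, \<open>3 * c\<close> pays for the floor and \<open>c * ln 2\<close> for replacing
      \<open>ln x\<close> by \<open>ln H\<close>. The factor 4 in \<open>x^2\<close> cancels the 4
      signed copies of each solution.\<close>
    show "\<forall>\<^sub>F H in at_top. norm (real (C_sym H) - 2 * ln 2 / pi\<^sup>2 * H\<^sup>2 * ln H)
        \<le> (72 + \<bar>B\<bar> + 3 * c + c * ln 2) * norm (H\<^sup>2)"
      using eventually_ge_at_top[of 1]
    proof eventually_elim
      case (elim H)
      define x where "x = 2 * H"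
      define n where "n = nat \<lfloor>x\<rfloor>"
      note floor = square_ln_floor_le[of x, folded n_def]
      have n: "1 \<le> real n" "real n \<le> x" "\<bar>(real n)\<^sup>2 * ln n - x\<^sup>2 * ln x\<bar> \<le> 3 * x\<^sup>2"
        using floor elim by (auto simp: x_def)
      have sq: "(real n)\<^sup>2 \<le> x\<^sup>2" "(2 * real n + 1)\<^sup>2 \<le> 9 * x\<^sup>2"
        using n power_mono[of "2 * real n + 1" "3 * x" 2] by (auto intro!: power_mono simp: power_mult_distrib)
      have "4 * real (C_sym H) = 4 * real (card (ordered_solutions n))"
        using elim by (simp add: C_sym_eq_card n_def x_def)
      then have 1: "\<bar>real (card (prim_quads n)) - 4 * real (C_sym H)\<bar> \<le> 72 * x\<^sup>2"
        using card_signed_ordered[of n] sq by (simp add: card_signed_solutions)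
      have "B * (real n)\<^sup>2 \<le> \<bar>B\<bar> * x\<^sup>2"
        using sq by (intro mult_mono) auto
      then have 2: "\<bar>real (card (prim_quads n)) - c * (real n)\<^sup>2 * ln n\<bar> \<le> \<bar>B\<bar> * x\<^sup>2"
        using B[of n] n by (simp add: c_def)
      have "c * \<bar>(real n)\<^sup>2 * ln n - x\<^sup>2 * ln x\<bar> \<le> c * (3 * x\<^sup>2)"
        using n c by (intro mult_left_mono) auto
      then have 3: "\<bar>c * (real n)\<^sup>2 * ln n - c * x\<^sup>2 * ln x\<bar> \<le> 3 * c * x\<^sup>2"
        using c by (simp add: abs_mult_pos' right_diff_distrib mult_ac)
      have 4: "c * x\<^sup>2 * ln x = c * x\<^sup>2 * ln H + c * ln 2 * x\<^sup>2"
        using elim by (simp add: x_def ln_mult algebra_simps)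
      have "c * ln 2 * x\<^sup>2 \<ge> 0"
        using c by simp
      then have "\<bar>4 * real (C_sym H) - c * x\<^sup>2 * ln H\<bar> \<le> (72 + \<bar>B\<bar> + 3 * c + c * ln 2) * x\<^sup>2"
        using 1 2 3 4 by (simp add: distrib_right)
      moreover have "4 * real (C_sym H) - c * x\<^sup>2 * ln H = 4 * (real (C_sym H) - c * H\<^sup>2 * ln H)"
        "(72 + \<bar>B\<bar> + 3 * c + c * ln 2) * x\<^sup>2 = 4 * ((72 + \<bar>B\<bar> + 3 * c + c * ln 2) * H\<^sup>2)"
        by (simp_all add: x_def power_mult_distrib)
      ultimately show ?case
        by (simp add: abs_mult flip: c_def)
    qed
  qed
qed

end
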